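(* Let $0.005<c<1$ and, for $0<x<1$, set $$f(x)=\frac{\left(\sum_{n=1}^{\infty}\frac{n^{2}}{n+1}c^{n}x^{n}\right)^{4}}{\left(\frac{x^{2}(1+x^{2})}{(1-x^{2})^{3}}\right)\left(\sum_{n=1}^{\infty}\frac{n^{2}}{(n+1)^{2}}x^{2n}\right)}.$$ For $c<x<1$ define $$A_1(c,x)=\frac{7}{(1-x^2)(1-cx)}+\frac{7}{2(1+x^2)(1+cx)}+\frac12,$$ $$A_2(c,x)=\frac{8}{(1-cx)(1-x^2)}+\frac{4(cx^3-1)}{(1+x^4)(1+c^2x^2)}+5+\frac{2}{(1+cx)(1+x^2)}.$$ Then $A_1(c,x)>0$ and $A_2(c,x)>0$, and for every $x$ with $c<x<1$: (i) if $0.005<c<0.27$ and $x<0.27^2/c$, then $(\log f)'(x)<(c-x)A_1(c,x)<0$; (ii) in all other cases, $(\log f)'(x)<(c-x)A_2(c,x)<0$. Consequently, $f$ is strictly decreasing on $[c,1)$.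
   Context: Here $c$ is a fixed real parameter, $f$ is a function of the real variable $x$ (depending on $c$), $\log$ is the natural logarithm, and the prime denotes the derivative with respect to $x$. All the series converge for $0<x<1$, $0<c<1$, and $f>0$ there. *)

theory Defs
  imports "HOL-Analysis.Analysis"
begin

(* suminf ranges over n = 0, 1, 2, ...; the series start at n = 1, so the index is Suc n. *)

definition f_num_series :: "real \<Rightarrow> real \<Rightarrow> real" where
  "f_num_series c x = (\<Sum>n. (real (Suc n))\<^sup>2 / (real (Suc n) + 1) * c ^ Suc n * x ^ Suc n)"

definition f_den_series :: "real \<Rightarrow> real" where
  "f_den_series x = (\<Sum>n. (real (Suc n))\<^sup>2 / (real (Suc n) + 1)\<^sup>2 * x ^ (2 * Suc n))"

definition f_ratio :: "real \<Rightarrow> real \<Rightarrow> real" where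
  "f_ratio c x =
     (f_num_series c x) ^ 4 / ((x\<^sup>2 * (1 + x\<^sup>2) / (1 - x\<^sup>2) ^ 3) * f_den_series x)"

definition A1 :: "real \<Rightarrow> real \<Rightarrow> real" where
  "A1 c x = 7 / ((1 - x\<^sup>2) * (1 - c * x)) + 7 / (2 * (1 + x\<^sup>2) * (1 + c * x)) + 1 / 2"

definition A2 :: "real \<Rightarrow> real \<Rightarrow> real" where
  "A2 c x = 8 / ((1 - c * x) * (1 - x\<^sup>2))
     + 4 * (c * x ^ 3 - 1) / ((1 + x ^ 4) * (1 + c\<^sup>2 * x\<^sup>2))
     + 5 + 2 / ((1 + c * x) * (1 + x\<^sup>2))"

end

theory Submission
  imports Defs
begin

text \<open>With \<open>t = c x\<close> and \<open>y = x\<^sup>2\<close>, partial fractions show that \<open>x (c - x) A\<^sub>i\<close> equals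
  \<open>G\<^sub>i(t) - G\<^sub>i(y)\<close> for a rational function \<open>G\<^sub>i\<close> of one variable, and \<open>x (ln f)'\<close> splits in the same
  way. So it suffices to separate the two sides by a constant: the part in \<open>t\<close> lies below it and
  the part in \<open>y\<close> above it. Clearing the denominators \<open>1 - t\<^sup>4\<close> and \<open>(1 - y)(1 + y\<^sup>2)\<close>, each of
  these two inequalities for \<open>i = 2\<close> says that a power series is positive; its coefficients are
  nonnegative from some index on, and the finitely many terms before have a positive sum.
  The difference \<open>G\<^sub>2(t) - G\<^sub>1(t) - 5/2\<close> is nonnegative, so the bound in \<open>y\<close> for \<open>i = 1\<close> follows,
  and it is so small for \<open>t < 0.27\<^sup>2\<close> that the bound in \<open>t\<close> survives.\<close>

section \<open>Power series and the operator x d/dx\<close>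

definition powser :: "(nat \<Rightarrow> real) \<Rightarrow> real \<Rightarrow> real" where
  "powser a x = (\<Sum>n. a n * x ^ n)"

text \<open>Coefficients of x d/dx applied to \<open>powser a\<close>; x times a logarithmic
  derivative becomes a quotient of two power series.\<close>

definition theta :: "(nat \<Rightarrow> real) \<Rightarrow> nat \<Rightarrow> real" where
  "theta a n = real n * a n"

text \<open>This sequence and \<open>den_coeff\<close> vanish at 0, so the sums over
  \<open>Suc n\<close> in \<open>f_ratio\<close> are full power series in \<open>c * x\<close> and
  \<open>x^2\<close>.\<close>

definition num_coeff :: "nat \<Rightarrow> real" where
  "num_coeff n = (real n)\<^sup>2 / (real n + 1)"

definition den_coeff :: "nat \<Rightarrow> real" where
  "den_coeff n = (real n)\<^sup>2 / (real n + 1)\<^sup>2"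

lemma powser_sums:
  assumes "\<And>n. \<bar>a n\<bar> \<le> real n" and "\<bar>x\<bar> < 1"
  shows "(\<lambda>n. a n * x ^ n) sums powser a x"
proof -
  have "summable (\<lambda>n. real (Suc n) * \<bar>x\<bar> ^ n)"
    using geometric_deriv_sums[of "\<bar>x\<bar>"] assms(2) by (auto simp: sums_iff)
  then have "summable (\<lambda>n. a n * x ^ n)"
  proof (rule summable_comparison_test'[where N = 0])
    fix n
    have "\<bar>a n\<bar> \<le> real (Suc n)" using assms(1)[of n] by simp
    then show "norm (a n * x ^ n) \<le> real (Suc n) * \<bar>x\<bar> ^ n"
      by (auto simp: abs_mult power_abs intro: mult_right_mono)
  qed
  then show ?thesis by (simp add: powser_def summable_sums)
qed

lemma theta_sums_deriv:
  assumes "\<And>n. \<bar>a n\<bar> \<le> real n" and "\<bar>x\<bar> < 1" and "x \<noteq> 0"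
  shows "(\<lambda>n. theta a n * x ^ n) sums powser (theta a) x"
    and "(powser a has_real_derivative powser (theta a) x / x) (at x)"
proof -
  have summable: "summable (\<lambda>n. a n * z ^ n)" if "norm z < 1" for z
    using powser_sums[OF assms(1)] that by (auto simp: sums_iff)
  have "(\<lambda>n. diffs a n * x ^ n) sums (\<Sum>n. diffs a n * x ^ n)"
    by (rule summable_sums, rule termdiff_converges[where K = 1]) (use assms summable in auto)
  then have "(\<lambda>n. x * (diffs a n * x ^ n)) sums (x * (\<Sum>n. diffs a n * x ^ n))"
    by (rule sums_mult)
  then have "(\<lambda>n. theta a (Suc n) * x ^ Suc n) sums (x * (\<Sum>n. diffs a n * x ^ n))"
    by (simp add: diffs_def theta_def mult_ac)
  \<comment> \<open>The term added at index 0 is zero because of the factor \<open>real n\<close> in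
    \<open>theta\<close>.\<close>
  then have *: "(\<lambda>n. theta a n * x ^ n) sums (x * (\<Sum>n. diffs a n * x ^ n))"
    by (subst (asm) sums_Suc_iff) (simp add: theta_def)
  then have eq: "powser (theta a) x = x * (\<Sum>n. diffs a n * x ^ n)"
    by (simp add: powser_def sums_iff)
  show "(\<lambda>n. theta a n * x ^ n) sums powser (theta a) x"
    using * eq by simp
  have "((\<lambda>z. \<Sum>n. a n * z ^ n) has_real_derivative (\<Sum>n. diffs a n * x ^ n)) (at x)"
    by (rule termdiffs_strong'[where K = 1]) (use summable assms in auto)
  then show "(powser a has_real_derivative powser (theta a) x / x) (at x)"
    using assms(3) unfolding eq by (simp add: powser_def[abs_def])
qed

text \<open>Since \<open>a 0 = 0\<close>, truncated subtraction gives the correct coefficient 0 for \<open>n < k\<close>.\<close>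
lemma powser_shift_sums:
  fixes a :: "nat \<Rightarrow> real"
  assumes "(\<lambda>n. a n * x ^ n) sums s" and "a 0 = 0"
  shows "(\<lambda>n. a (n - k) * x ^ n) sums (x ^ k * s)"
proof -
  have "(\<lambda>n. a (n + k - k) * x ^ (n + k)) sums (x ^ k * s)"
    using sums_mult[OF assms(1), of "x ^ k"] by (simp add: power_add mult_ac)
  then show ?thesis
    by (subst (asm) sums_zero_iff_shift) (use assms(2) in auto)
qed

section \<open>Coefficient estimates\<close>

lemma num_coeff_le: "\<bar>num_coeff n\<bar> \<le> real n"
  and den_coeff_le: "\<bar>den_coeff n\<bar> \<le> real n"
proof -
  have "(real n)\<^sup>2 \<le> real n * (real n + 1)" "(real n)\<^sup>2 \<le> real n * (real n + 1)\<^sup>2"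
    by (auto simp: power2_eq_square algebra_simps)
  then show "\<bar>num_coeff n\<bar> \<le> real n" "\<bar>den_coeff n\<bar> \<le> real n"
    by (simp_all add: num_coeff_def den_coeff_def divide_le_eq)
qed

lemma num_coeff_0 [simp]: "num_coeff 0 = 0" "theta num_coeff 0 = 0"
  and den_coeff_0 [simp]: "den_coeff 0 = 0" "theta den_coeff 0 = 0"
  by (simp_all add: num_coeff_def den_coeff_def theta_def)

text \<open>The coefficient of \<open>t^(m+5)\<close> in \<open>num_powser_bound\<close>. In partial
  fractions the polynomial parts cancel; the numerators of the remaining reciprocals have the
  positive sum 32, and clearing denominators leaves a polynomial inequality in
  \<open>m\<close>.\<close>

lemma num_coeff_combination_nonneg:
  "0 \<le> 4 * num_coeff (m + 5) + 11 * num_coeff (m + 4) + 6 * num_coeff (m + 3)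
     + 14 * num_coeff (m + 2) + 2 * num_coeff (m + 1) - 5 * num_coeff m
     - 4 * theta num_coeff (m + 5) + 4 * theta num_coeff (m + 1)" (is "0 \<le> ?e")
proof -
  have coeff: "num_coeff k = real k - 1 + 1 / (real k + 1)" for k
    by (simp add: num_coeff_def field_simps power2_eq_square)
  have theta: "theta num_coeff k = (real k)\<^sup>2 - real k + 1 - 1 / (real k + 1)" for k
    by (simp add: theta_def num_coeff_def field_simps power2_eq_square)
  have "?e = 8 / (m + 6) + 11 / (m + 5) + 6 / (m + 4) + 14 / (m + 3) - 2 / (m + 2) - 5 / (m + 1)"
    unfolding theta coeff by (simp add: algebra_simps power2_eq_square)
  also have "\<dots> \<ge> 0"
    by (simp add: divide_simps) (simp add: algebra_simps)
  finally show ?thesis .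
qed

text \<open>The coefficient of \<open>y^(m+6)\<close> in \<open>den_powser_bound\<close>, right side
  minus left. Again the polynomial parts cancel, and the first-order reciprocals have numerators of
  sum 4. The shift by 6 is sharp: the same combination at index 5 is
  \<open>-511/7200\<close>.\<close>

lemma den_coeff_combination_nonneg:
  "0 \<le> theta den_coeff (m + 6) - theta den_coeff (m + 5) + theta den_coeff (m + 4)
     - theta den_coeff (m + 3) - den_coeff (m + 6) - 1/2 * den_coeff (m + 5)
     - 1/2 * den_coeff (m + 4) - 5/2 * den_coeff (m + 3) + 5/2 * den_coeff (m + 2)" (is "0 \<le> ?e")
proof -
  have coeff: "den_coeff k = 1 - 2 / (real k + 1) + 1 / (real k + 1)\<^sup>2" for k
    by (simp add: den_coeff_def add_divide_eq_iff divide_eq_eq diff_divide_eq_iff)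
      (simp add: field_simps power2_eq_square)
  have theta: "theta den_coeff k = real k - 2 + 3 / (real k + 1) - 1 / (real k + 1)\<^sup>2" for k
  proof -
    define N where "N = real k + 1"
    have "N \<noteq> 0" by (simp add: N_def)
    then have "(N - 1) * ((N - 1)\<^sup>2 / N\<^sup>2) = N - 3 + 3 / N - 1 / N\<^sup>2"
      by (simp add: field_simps power2_eq_square)
    then show ?thesis by (simp add: N_def theta_def den_coeff_def)
  qed
  have "?e = (5 / (m + 7) + 4 / (m + 5) + 2 / (m + 4) + (1/2) / (m + 6)\<^sup>2 + (5/2) / (m + 3)\<^sup>2)
     - (2 / (m + 6) + 5 / (m + 3) + 2 / (m + 7)\<^sup>2 + (3/2) / (m + 5)\<^sup>2 + (3/2) / (m + 4)\<^sup>2)"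
    unfolding theta coeff by (simp add: algebra_simps)
  also have "\<dots> \<ge> 0"
    by (simp add: divide_simps) (simp add: algebra_simps power2_eq_square)
  finally show ?thesis .
qed

section \<open>The two one-variable inequalities with denominators cleared\<close>

text \<open>The polynomial before \<open>S\<close> is \<open>1 - t^4\<close> times the upper bound
  for \<open>4 * T / S\<close>. The left side is an explicit margin, which the sharper bound for
  small \<open>t\<close> spends later.\<close>

lemma num_powser_bound:
  assumes "0 < t" and "t < 1"
  defines "S \<equiv> powser num_coeff t" and "T \<equiv> powser (theta num_coeff) t"
  shows "t\<^sup>2 * (1/6 - t/3 + 27/20 * t\<^sup>2)
    \<le> (4 + 11 * t + 6 * t^2 + 14 * t^3 + 2 * t^4 - 5 * t^5) * S - 4 * (1 - t^4) * T"
proof -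
  define e where "e n = 4 * num_coeff n + 11 * num_coeff (n - 1) + 6 * num_coeff (n - 2)
     + 14 * num_coeff (n - 3) + 2 * num_coeff (n - 4) - 5 * num_coeff (n - 5)
     - 4 * theta num_coeff n + 4 * theta num_coeff (n - 4)" for n
  have S: "(\<lambda>n. num_coeff n * t ^ n) sums S" and T: "(\<lambda>n. theta num_coeff n * t ^ n) sums T"
    using powser_sums[OF num_coeff_le] theta_sums_deriv(1)[OF num_coeff_le] assms by auto
  note S_shift = powser_shift_sums[OF S num_coeff_0(1)]
    and T_shift = powser_shift_sums[OF T num_coeff_0(2)]
  have "(\<lambda>n. e n * t ^ n) sums (4 * S + 11 * (t ^ 1 * S) + 6 * (t ^ 2 * S) + 14 * (t ^ 3 * S)
      + 2 * (t ^ 4 * S) - 5 * (t ^ 5 * S) - 4 * T + 4 * (t ^ 4 * T))"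
    unfolding e_def distrib_right left_diff_distrib mult.assoc
    by (intro sums_add sums_diff sums_mult S T S_shift T_shift)
  then have sums: "(\<lambda>n. e n * t ^ n) sums
      ((4 + 11 * t + 6 * t^2 + 14 * t^3 + 2 * t^4 - 5 * t^5) * S - 4 * (1 - t^4) * T)"
    by (simp add: algebra_simps)
  have nonneg: "0 \<le> e n" if "n \<ge> 5" for n
  proof -
    obtain m where "n = m + 5" using \<open>n \<ge> 5\<close> by (metis le_add_diff_inverse2)
    then show ?thesis using num_coeff_combination_nonneg[of m] by (simp add: e_def add.commute)
  qed
  \<comment> \<open>The coefficients at 0 and 1 vanish, so the kept terms start with
    \<open>t^2\<close>.\<close>
  have "(\<Sum>n<5. e n * t ^ n) \<le> (\<Sum>n. e n * t ^ n)"
    using sums nonneg assms by (intro sum_le_suminf) (auto simp: sums_iff)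
  moreover have "(\<Sum>n<5. e n * t ^ n) = t\<^sup>2 * (1/6 - t/3 + 27/20 * t\<^sup>2)"
    by (simp add: eval_nat_numeral e_def num_coeff_def theta_def algebra_simps)
  ultimately show ?thesis using sums by (simp add: sums_iff)
qed

text \<open>The polynomial is \<open>(1 - y) * (1 + y^2)\<close> times
  \<open>1 / (1 - y) - 2 * y / (1 + y^2) + 5/2 * y\<close>, the lower bound for \<open>T / D\<close>
  used in \<open>den_log_deriv_greater\<close>.\<close>

lemma den_powser_bound:
  assumes "0 < y" and "y < 1"
  defines "D \<equiv> powser den_coeff y" and "T \<equiv> powser (theta den_coeff) y"
  shows "(1 + y/2 + y^2/2 + 5/2 * y^3 - 5/2 * y^4) * D < (1 - y) * (1 + y\<^sup>2) * T"
proof -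
  define e where "e n = theta den_coeff n - theta den_coeff (n - 1) + theta den_coeff (n - 2)
     - theta den_coeff (n - 3) - den_coeff n - 1/2 * den_coeff (n - 1)
     - 1/2 * den_coeff (n - 2) - 5/2 * den_coeff (n - 3) + 5/2 * den_coeff (n - 4)" for n
  have D: "(\<lambda>n. den_coeff n * y ^ n) sums D" and T: "(\<lambda>n. theta den_coeff n * y ^ n) sums T"
    using powser_sums[OF den_coeff_le] theta_sums_deriv(1)[OF den_coeff_le] assms by auto
  note D_shift = powser_shift_sums[OF D den_coeff_0(1)]
    and T_shift = powser_shift_sums[OF T den_coeff_0(2)]
  have "(\<lambda>n. e n * y ^ n) sums (T - y ^ 1 * T + y ^ 2 * T - y ^ 3 * T - D - 1/2 * (y ^ 1 * D)
      - 1/2 * (y ^ 2 * D) - 5/2 * (y ^ 3 * D) + 5/2 * (y ^ 4 * D))"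
    unfolding e_def distrib_right left_diff_distrib mult.assoc
    by (intro sums_add sums_diff sums_mult D T D_shift T_shift)
  then have sums: "(\<lambda>n. e n * y ^ n) sums ((1 - y) * (1 + y\<^sup>2) * T
      - (1 + y/2 + y^2/2 + 5/2 * y^3 - 5/2 * y^4) * D)"
    by (simp add: algebra_simps power2_eq_square power3_eq_cube)
  have nonneg: "0 \<le> e n" if "n \<ge> 6" for n
  proof -
    obtain m where "n = m + 6" using \<open>n \<ge> 6\<close> by (metis le_add_diff_inverse2)
    then show ?thesis using den_coeff_combination_nonneg[of m] by (simp add: e_def add.commute)
  qed
  \<comment> \<open>Terms 6 and 7 are kept although nonnegative: at \<open>y = 1\<close> the first
    six or seven terms have a negative sum, all eight a positive one.\<close>
  have "(\<Sum>n<8. e n * y ^ n) \<le> (\<Sum>n. e n * y ^ n)"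
    using sums nonneg assms by (intro sum_le_suminf) (auto simp: sums_iff)
  moreover have "0 < (\<Sum>n<8. e n * y ^ n)"
  proof -
    \<comment> \<open>A lower bound with rounded coefficients, in the Bernstein basis of degree 5.\<close>
    have "0 < 69 * (1 - y)^5 + 483 * y * (1 - y)^4 + 984 * y^2 * (1 - y)^3
        + 673 * y^3 * (1 - y)^2 + 92 * y^4 * (1 - y) + 178 * y^5"
      using assms by (intro add_pos_pos mult_pos_pos) simp_all
    also have "\<dots> = 69 + 138 * y - 258 * y^2 - 71 * y^3 + 111 * y^4 + 189 * y^5"
      by (simp add: power_numeral_reduce algebra_simps)
    finally have "0 < 69/1000 + 138/1000 * y - 258/1000 * y^2 - 71/1000 * y^3
        + 111/1000 * y^4 + 189/1000 * y^5" by linarith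
    also have "\<dots> \<le> 5/72 + 5/36 * y - 617/2400 * y^2 - 511/7200 * y^3
        + 13099/117600 * y^4 + 1857/9800 * y^5"
      using assms(1) by (intro add_mono diff_mono mult_right_mono) simp_all
    finally have "0 < y^2 * (5/72 + 5/36 * y - 617/2400 * y^2 - 511/7200 * y^3
        + 13099/117600 * y^4 + 1857/9800 * y^5)"
      using assms by simp
    also have "\<dots> = (\<Sum>n<8. e n * y ^ n)"
      by (simp add: eval_nat_numeral e_def den_coeff_def theta_def algebra_simps)
    finally show ?thesis .
  qed
  ultimately show ?thesis using sums by (simp add: sums_iff)
qed


section \<open>Positivity and a geometric majorant\<close>

lemma num_powser_pos:
  assumes "0 < t" and "t < 1" shows "0 < powser num_coeff t"
proof -
  have "(\<lambda>n. num_coeff n * t ^ n) sums powser num_coeff t"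
    using powser_sums[OF num_coeff_le] assms by auto
  moreover have "0 \<le> num_coeff n" for n by (simp add: num_coeff_def)
  ultimately have "(\<Sum>n\<in>{1}. num_coeff n * t ^ n) \<le> powser num_coeff t"
    using assms by (intro sum_le_suminf[of _ "{1}", THEN order_trans]) (auto simp: sums_iff)
  then show ?thesis using assms by (simp add: num_coeff_def)
qed

lemma den_powser_pos:
  assumes "0 < y" and "y < 1" shows "0 < powser den_coeff y"
proof -
  have "(\<lambda>n. den_coeff n * y ^ n) sums powser den_coeff y"
    using powser_sums[OF den_coeff_le] assms by auto
  moreover have "0 \<le> den_coeff n" for n by (simp add: den_coeff_def)
  ultimately have "(\<Sum>n\<in>{1}. den_coeff n * y ^ n) \<le> powser den_coeff y"
    using assms by (intro sum_le_suminf[of _ "{1}", THEN order_trans]) (auto simp: sums_iff)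
  then show ?thesis using assms by (simp add: den_coeff_def)
qed

text \<open>The coefficient at \<open>n + 1\<close> is at most
  \<open>(1 + 2 * n) / 2 \<le> 3^n / 2\<close> by Bernoulli. This shows that the series is of order
  \<open>t\<close>, as needed in \<open>num_log_deriv_less_small\<close>.\<close>

lemma num_powser_le:
  assumes "0 < t" and "3 * t < 1" shows "powser num_coeff t \<le> t / (2 * (1 - 3 * t))"
proof (rule sums_le)
  show "num_coeff (Suc n) * t ^ Suc n \<le> t / 2 * (3 * t) ^ n" for n
  proof -
    have "num_coeff (Suc n) \<le> (1 + 2 * real n) / 2"
      by (simp add: num_coeff_def divide_simps) (simp add: algebra_simps power2_eq_square)
    also have "\<dots> \<le> 3 ^ n / 2"
      using Bernoulli_inequality[of "2::real" n] by (simp add: mult.commute)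
    finally have "num_coeff (Suc n) * t ^ Suc n \<le> 3 ^ n / 2 * t ^ Suc n"
      using assms by (intro mult_right_mono) auto
    then show ?thesis by (simp add: power_mult_distrib mult_ac)
  qed
  have "(\<lambda>n. num_coeff n * t ^ n) sums powser num_coeff t"
    using powser_sums[OF num_coeff_le] assms by auto
  then show "(\<lambda>n. num_coeff (Suc n) * t ^ Suc n) sums powser num_coeff t"
    by (subst sums_Suc_iff) simp
  show "(\<lambda>n. t / 2 * (3 * t) ^ n) sums (t / (2 * (1 - 3 * t)))"
    using sums_mult[OF geometric_sums[of "3 * t"], of "t / 2"] assms by simp
qed

section \<open>Logarithmic derivative bounds in \<open>t\<close> and in \<open>y\<close>\<close>

text \<open>This is \<open>num_powser_bound\<close> divided by \<open>(1 - t^4) * S\<close>. The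
  constant \<open>-2\<close> makes both sides tend to 4 as \<open>t\<close> tends to 0.\<close>

lemma num_log_deriv_less:
  assumes "0 < t" and "t < 1"
  shows "4 * powser (theta num_coeff) t / powser num_coeff t
    < 8 / (1 - t) - 2 / (1 + t) - 4 * t / (1 + t\<^sup>2) + 5 * t - 2"
proof -
  define S T where "S = powser num_coeff t" and "T = powser (theta num_coeff) t"
  define z where "z = (1 - t) * (1 + t) * (1 + t\<^sup>2)"
  have z: "z = 1 - t^4" by (simp add: z_def power_numeral_reduce algebra_simps)
  have "z > 0" "S > 0" "1 + t\<^sup>2 > 0"
    using assms num_powser_pos by (auto simp: z_def S_def add_pos_nonneg)
  have parts: "z * (8 / (1 - t)) = 8 * ((1 + t) * (1 + t\<^sup>2))"
    "z * (2 / (1 + t)) = 2 * ((1 - t) * (1 + t\<^sup>2))"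
    "z * (4 * t / (1 + t\<^sup>2)) = 4 * t * ((1 - t) * (1 + t))"
    using assms \<open>1 + t\<^sup>2 > 0\<close> by (simp_all add: z_def)
  have "0 < (1/6 - t/3 + 27/20 * t\<^sup>2)"
  proof -
    \<comment> \<open>Equivalent to \<open>2 * (t - 1/4)^2 \<ge> 0\<close>; it absorbs the only
      negative term \<open>- t/3\<close>.\<close>
    have "t \<le> 2 * t\<^sup>2 + 1/8"
      using zero_le_power2[of "t - 1/4"] by (simp add: power2_eq_square algebra_simps)
    then show ?thesis using zero_le_power2[of t] by linarith
  qed
  then have "0 < t\<^sup>2 * (1/6 - t/3 + 27/20 * t\<^sup>2)"
    using assms by simp
  then have "4 * z * T < (4 + 11 * t + 6 * t^2 + 14 * t^3 + 2 * t^4 - 5 * t^5) * S"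
    using num_powser_bound[OF assms] unfolding S_def T_def z by linarith
  also have "4 + 11 * t + 6 * t^2 + 14 * t^3 + 2 * t^4 - 5 * t^5
    = z * (8 / (1 - t) - 2 / (1 + t) - 4 * t / (1 + t\<^sup>2) + 5 * t - 2)"
    unfolding distrib_left[of z] right_diff_distrib[of z] parts by (simp add: z power_numeral_reduce algebra_simps)
  finally show ?thesis
    using \<open>z > 0\<close> \<open>S > 0\<close> by (simp add: S_def T_def divide_less_eq mult_ac)
qed

text \<open>\<open>0.0729 = 0.27^2\<close> is the threshold for \<open>c * x\<close> in case (i).
  Lowering the bound of \<open>num_log_deriv_less\<close> by \<open>t^2 * d\<close> costs
  \<open>t^2 * z * d * S\<close> after clearing denominators. As \<open>S\<close> is of order
  \<open>t\<close>, this stays below the margin of \<open>num_powser_bound\<close>.\<close>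

lemma num_log_deriv_less_small:
  assumes "0 < t" and "t < 0.0729"
  shows "4 * powser (theta num_coeff) t / powser num_coeff t
    < 7 / (1 - t) - 7 / (2 * (1 + t)) + t / 2 + 1 / 2"
proof -
  define S T where "S = powser num_coeff t" and "T = powser (theta num_coeff) t"
  define z where "z = (1 - t) * (1 + t) * (1 + t\<^sup>2)"
  \<comment> \<open>\<open>t\<^sup>2 d\<close> is the amount by which this bound is smaller than that of \<open>num_log_deriv_less\<close>.\<close>
  define d where "d = 1 / (1 - t) + 3 / (2 * (1 + t)) + 4 * t / (1 + t\<^sup>2)"
  have z: "z = 1 - t^4" by (simp add: z_def power_numeral_reduce algebra_simps)
  have "z > 0" "S > 0" "1 + t\<^sup>2 > 0"
    using assms num_powser_pos by (auto simp: z_def S_def add_pos_nonneg)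
  have "2 + 2 * t \<noteq> 0" "1 - t \<noteq> 0" "1 + t \<noteq> 0" "1 + t\<^sup>2 \<noteq> 0"
    using assms \<open>1 + t\<^sup>2 > 0\<close> by auto
  then have parts: "z * (1 / (1 - t)) = (1 + t) * (1 + t\<^sup>2)"
    "z * (7 / (1 - t)) = 7 * ((1 + t) * (1 + t\<^sup>2))"
    "z * (3 / (2 * (1 + t))) = 3 / 2 * ((1 - t) * (1 + t\<^sup>2))"
    "z * (7 / (2 * (1 + t))) = 7 / 2 * ((1 - t) * (1 + t\<^sup>2))"
    "z * (4 * t / (1 + t\<^sup>2)) = 4 * t * ((1 - t) * (1 + t))"
    by (simp_all add: z_def divide_eq_eq)
  have "z \<le> 1" by (simp add: z)
  have "d \<ge> 0" using assms by (auto simp: d_def intro!: add_nonneg_nonneg)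
  \<comment> \<open>Numerically, \<open>1.08 + 1.5 + 4 * 0.0729 < 72/25\<close>.\<close>
  have "d \<le> 72/25"
  proof -
    have "1 / (1 - t) \<le> 1.08" "3 / (2 * (1 + t)) \<le> 1.5" using assms by (simp_all add: divide_simps)
    moreover have "4 * t / (1 + t\<^sup>2) \<le> 4 * t / 1" using assms \<open>1 + t\<^sup>2 > 0\<close> by (intro divide_left_mono) auto
    ultimately have "d \<le> 1.08 + 1.5 + 4 * t / 1" unfolding d_def by (intro add_mono)
    then show ?thesis using assms by simp
  qed
  \<comment> \<open>At \<open>t = 0.0729\<close> the factor \<open>1 / (2 * (1 - 3 * t))\<close> is
    just below \<open>16/25\<close>.\<close>
  have "S \<le> 16/25 * t"
  proof -
    have "S \<le> t / (2 * (1 - 3 * t))" using num_powser_le[of t] assms by (simp add: S_def)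
    also have "\<dots> \<le> 16/25 * t" using assms by (simp add: divide_le_eq)
    finally show ?thesis .
  qed
  have "z * d * S \<le> 1 * (72/25) * (16/25 * t)"
    using \<open>z \<le> 1\<close> \<open>d \<le> 72/25\<close> \<open>S \<le> 16/25 * t\<close> \<open>z > 0\<close> \<open>d \<ge> 0\<close> \<open>S > 0\<close>
    by (intro mult_mono) auto
  also have "\<dots> < 1/6 - t/3 + 27/20 * t\<^sup>2"
  proof -
    have "t < 729/10000" using assms by simp
    then show ?thesis using zero_le_power2[of t] by linarith
  qed
  finally have "t\<^sup>2 * (z * d * S) < t\<^sup>2 * (1/6 - t/3 + 27/20 * t\<^sup>2)"
    using assms by simp
  then have "4 * z * T < (4 + 11 * t + 6 * t^2 + 14 * t^3 + 2 * t^4 - 5 * t^5 - t\<^sup>2 * (z * d)) * S"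
    using num_powser_bound[of t] assms by (simp add: S_def T_def z algebra_simps)
  also have "4 + 11 * t + 6 * t^2 + 14 * t^3 + 2 * t^4 - 5 * t^5 - t\<^sup>2 * (z * d)
    = z * (7 / (1 - t) - 7 / (2 * (1 + t)) + t / 2 + 1 / 2)"
    unfolding d_def distrib_left[of z] right_diff_distrib[of z] parts
    by (simp add: z power_numeral_reduce algebra_simps) (simp add: field_simps)
  finally show ?thesis
    using \<open>z > 0\<close> \<open>S > 0\<close> by (simp add: S_def T_def divide_less_eq mult_ac)
qed

text \<open>Splitting \<open>8 / (1 - y)\<close> and \<open>2 / (1 + y)\<close> cancels the rational
  terms on the right, which come from the prefactor of the denominator of f. What remains is twice
  \<open>den_powser_bound\<close> divided by \<open>z * D\<close>.\<close>

lemma den_log_deriv_greater: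
  assumes "0 < y" and "y < 1"
  shows "8 / (1 - y) - 2 / (1 + y) - 4 * y / (1 + y\<^sup>2) + 5 * y - 2
    < 2 * powser (theta den_coeff) y / powser den_coeff y + 2 + 2 * y / (1 + y) + 6 * y / (1 - y)"
proof -
  define D T where "D = powser den_coeff y" and "T = powser (theta den_coeff) y"
  define z where "z = (1 - y) * (1 + y\<^sup>2)"
  have "D > 0" "z > 0" "1 + y\<^sup>2 > 0"
    using assms den_powser_pos by (auto simp: z_def D_def add_pos_nonneg)
  have parts: "z * (1 / (1 - y)) = 1 + y\<^sup>2" "z * (2 * y / (1 + y\<^sup>2)) = 2 * y * (1 - y)"
    using assms \<open>1 + y\<^sup>2 > 0\<close> by (simp_all add: z_def)
  have "(1 + y/2 + y^2/2 + 5/2 * y^3 - 5/2 * y^4) * D < z * T"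
    using den_powser_bound[OF assms] by (simp add: D_def T_def z_def)
  also have "1 + y/2 + y^2/2 + 5/2 * y^3 - 5/2 * y^4
    = z * (1 / (1 - y) - 2 * y / (1 + y\<^sup>2) + 5/2 * y)"
    unfolding distrib_left[of z] right_diff_distrib[of z] parts by (simp add: z_def power_numeral_reduce) (simp add: field_simps)
  finally have "1 / (1 - y) - 2 * y / (1 + y\<^sup>2) + 5/2 * y < T / D"
    using \<open>z > 0\<close> \<open>D > 0\<close> by (simp add: less_divide_eq)
  moreover have "8 / (1 - y) = 2 / (1 - y) + 6 * y / (1 - y) + 6"
    "2 / (1 + y) + 2 * y / (1 + y) = 2"
    using assms by (simp_all add: divide_simps) (simp_all add: algebra_simps)
  ultimately show ?thesis unfolding D_def T_def by simp
qed

lemma den_log_deriv_greater':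
  assumes "0 < y" and "y < 1"
  shows "7 / (1 - y) - 7 / (2 * (1 + y)) + y / 2 + 1 / 2
    < 2 * powser (theta den_coeff) y / powser den_coeff y + 2 + 2 * y / (1 + y) + 6 * y / (1 - y)"
proof -
  define p q r where "p = 1 / (1 - y)" and "q = 1 / (1 + y)" and "r = y / (1 + y\<^sup>2)"
  have "1 + y\<^sup>2 > 0" by (simp add: add_pos_nonneg)
  \<comment> \<open>The left side of \<open>den_log_deriv_greater\<close> exceeds the present one by
    \<open>p + 3/2 * q - 4 * r + 9/2 * y - 5/2\<close>. With the linear Taylor parts split off,
    constants and multiples of \<open>y\<close> cancel, and the remainders contribute
    nonnegatively.\<close>
  then have "p = 1 + y + y\<^sup>2 / (1 - y)" "q = 1 - y + y\<^sup>2 / (1 + y)" "r = y - y^3 / (1 + y\<^sup>2)"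
    using assms by (simp_all add: p_def q_def r_def field_simps power2_eq_square power3_eq_cube)
  moreover have "0 \<le> y\<^sup>2 / (1 - y)" "0 \<le> y\<^sup>2 / (1 + y)" "0 \<le> y^3 / (1 + y\<^sup>2)"
    using assms by auto
  ultimately have "7 * p - 7/2 * q + y / 2 + 1/2 \<le> 8 * p - 2 * q - 4 * r + 5 * y - 2"
    by linarith
  then show ?thesis
    using den_log_deriv_greater[OF assms] by (simp add: p_def q_def r_def)
qed

section \<open>The logarithmic derivative of f\<close>

lemma f_num_series_powser:
  assumes "\<bar>c * x\<bar> < 1" shows "f_num_series c x = powser num_coeff (c * x)"
proof -
  have "(\<lambda>n. num_coeff (Suc n) * (c * x) ^ Suc n) sums powser num_coeff (c * x)"
    by (subst sums_Suc_iff) (use powser_sums[OF num_coeff_le assms] in simp)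
  then show ?thesis
    unfolding f_num_series_def by (simp add: sums_iff num_coeff_def power_mult_distrib mult_ac)
qed

lemma f_den_series_powser:
  assumes "\<bar>x\<bar> < 1" shows "f_den_series x = powser den_coeff (x\<^sup>2)"
proof -
  have "\<bar>x\<^sup>2\<bar> < 1" using assms by (simp add: abs_square_less_1)
  then have "(\<lambda>n. den_coeff (Suc n) * (x\<^sup>2) ^ Suc n) sums powser den_coeff (x\<^sup>2)"
    by (subst sums_Suc_iff) (use powser_sums[OF den_coeff_le] in simp)
  then have "(\<lambda>n. den_coeff (Suc n) * x ^ (2 * Suc n)) sums powser den_coeff (x\<^sup>2)"
    by (simp only: power_mult)
  then show ?thesis
    unfolding f_den_series_def by (simp only: sums_iff den_coeff_def)
qed

text \<open>Termwise derivative of the expanded logarithm \<open>g\<close>. Writing it over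
  \<open>x\<close> separates the numerator into a function of \<open>c * x\<close> and one of
  \<open>x^2\<close>.\<close>

lemma ln_f_ratio_deriv:
  assumes "0 < c" "c < 1" "0 < x" "x < 1"
  shows "((\<lambda>t. ln (f_ratio c t)) has_real_derivative
     (4 * powser (theta num_coeff) (c * x) / powser num_coeff (c * x)
      - (2 * powser (theta den_coeff) (x\<^sup>2) / powser den_coeff (x\<^sup>2)
         + 2 + 2 * x\<^sup>2 / (1 + x\<^sup>2) + 6 * x\<^sup>2 / (1 - x\<^sup>2))) / x) (at x)"
    and "0 < f_ratio c x"
proof -
  define g where "g u = 4 * ln (powser num_coeff (c * u)) - 2 * ln u - ln (1 + u\<^sup>2)
    + 3 * ln (1 - u\<^sup>2) - ln (powser den_coeff (u\<^sup>2))" for u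
  have range: "0 < c * u" "c * u < 1" "0 < u\<^sup>2" "u\<^sup>2 < 1" if "u \<in> {0<..<1}" for u
    using that assms mult_strict_mono[of c 1 u 1] by (auto simp: power_less_one_iff)
  have f: "f_ratio c u = powser num_coeff (c * u) ^ 4
      / ((u\<^sup>2 * (1 + u\<^sup>2) / (1 - u\<^sup>2) ^ 3) * powser den_coeff (u\<^sup>2))" if "u \<in> {0<..<1}" for u
    using range[OF that] that f_num_series_powser f_den_series_powser by (simp add: f_ratio_def)
  have eq: "g u = ln (f_ratio c u)" if "u \<in> {0<..<1}" for u
  proof -
    note pos = num_powser_pos[OF range(1,2)[OF that]] den_powser_pos[OF range(3,4)[OF that]]
      range[OF that]
    have "0 < u" "0 < 1 + u\<^sup>2" "0 < 1 - u\<^sup>2" using pos that by (auto simp: add_pos_nonneg)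
    moreover from this have "1 + u\<^sup>2 \<noteq> 0" by linarith
    ultimately show ?thesis
      using pos by (simp add: f[OF that] g_def ln_mult ln_div ln_realpow)
        (use \<open>1 + u\<^sup>2 \<noteq> 0\<close> in blast)
  qed
  have x: "x \<in> {0<..<1}" using assms by simp
  note pos = num_powser_pos[OF range(1,2)[OF x]] den_powser_pos[OF range(3,4)[OF x]] range[OF x]
  then show "0 < f_ratio c x"
    using assms unfolding f[OF x] by (auto intro!: divide_pos_pos mult_pos_pos add_pos_nonneg)
  have num: "(powser num_coeff has_real_derivative powser (theta num_coeff) (c * x) / (c * x)) (at (c * x))"
    and den: "(powser den_coeff has_real_derivative powser (theta den_coeff) (x\<^sup>2) / x\<^sup>2) (at (x\<^sup>2))"
    using theta_sums_deriv(2)[OF num_coeff_le, of "c * x"] theta_sums_deriv(2)[OF den_coeff_le, of "x\<^sup>2"] pos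
      assms by auto
  have "1 + x\<^sup>2 > 0" by (simp add: add_pos_nonneg)
  have "((\<lambda>u. ln (powser num_coeff (c * u))) has_real_derivative
      powser (theta num_coeff) (c * x) / powser num_coeff (c * x) / x) (at x)"
    by (rule DERIV_cong[OF DERIV_chain2[OF DERIV_ln DERIV_chain2[OF num DERIV_cmult_Id]]])
      (use pos assms in \<open>simp_all add: field_simps\<close>)
  moreover have "((\<lambda>u. ln (powser den_coeff (u\<^sup>2))) has_real_derivative
      2 * powser (theta den_coeff) (x\<^sup>2) / powser den_coeff (x\<^sup>2) / x) (at x)"
    by (rule DERIV_cong[OF DERIV_chain2[OF DERIV_ln DERIV_chain2[OF den DERIV_power[OF DERIV_ident]]]])
      (use pos assms in \<open>simp_all add: field_simps power2_eq_square\<close>)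
  moreover have "((\<lambda>u. ln (1 + u\<^sup>2)) has_real_derivative 2 * x\<^sup>2 / (1 + x\<^sup>2) / x) (at x)"
    by (rule derivative_eq_intros refl \<open>1 + x\<^sup>2 > 0\<close>)+ (use assms in \<open>simp add: power2_eq_square\<close>)
  moreover have "((\<lambda>u. ln (1 - u\<^sup>2)) has_real_derivative - (2 * x\<^sup>2 / (1 - x\<^sup>2) / x)) (at x)"
    by (rule derivative_eq_intros refl | use pos in simp; fail)+
      (use assms in \<open>simp add: power2_eq_square\<close>)
  moreover have "(ln has_real_derivative 1 / x) (at x)"
    by (rule DERIV_ln_divide) (use assms in simp)
  ultimately have "(g has_real_derivative 4 * (powser (theta num_coeff) (c * x) / powser num_coeff (c * x) / x)
      - 2 * (1 / x) - 2 * x\<^sup>2 / (1 + x\<^sup>2) / x + 3 * - (2 * x\<^sup>2 / (1 - x\<^sup>2) / x)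
      - 2 * powser (theta den_coeff) (x\<^sup>2) / powser den_coeff (x\<^sup>2) / x) (at x)"
    unfolding g_def[abs_def] by (intro DERIV_add DERIV_diff DERIV_cmult)
  then have "(g has_real_derivative
     (4 * powser (theta num_coeff) (c * x) / powser num_coeff (c * x)
      - (2 * powser (theta den_coeff) (x\<^sup>2) / powser den_coeff (x\<^sup>2)
         + 2 + 2 * x\<^sup>2 / (1 + x\<^sup>2) + 6 * x\<^sup>2 / (1 - x\<^sup>2))) / x) (at x)"
    by (rule DERIV_cong) (simp add: add_divide_distrib diff_divide_distrib)
  then show "((\<lambda>t. ln (f_ratio c t)) has_real_derivative
     (4 * powser (theta num_coeff) (c * x) / powser num_coeff (c * x)
      - (2 * powser (theta den_coeff) (x\<^sup>2) / powser den_coeff (x\<^sup>2)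
         + 2 + 2 * x\<^sup>2 / (1 + x\<^sup>2) + 6 * x\<^sup>2 / (1 - x\<^sup>2))) / x) (at x)"
    \<comment> \<open>The identity with \<open>g\<close> is established on the open interval (0,1),
      which suffices for the derivative at \<open>x\<close>.\<close>
    by (rule has_field_derivative_transform_within_open[where S = "{0<..<1}"]) (use eq x in auto)
qed

section \<open>Partial fractions and positivity of \<open>A1\<close> and \<open>A2\<close>\<close>

text \<open>\<open>x * (c - x)\<close> is \<open>t - y\<close>, and \<open>t - y\<close> over
  \<open>(1 - t) * (1 - y)\<close> is a difference of one-variable fractions. The constants
  \<open>1 / 2\<close> cancel; they match the form of
  \<open>num_log_deriv_less_small\<close>.\<close>

lemma A1_partial_fractions:
  assumes "0 < c" "c < 1" "0 < x" "x < 1"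
  defines "t \<equiv> c * x" and "y \<equiv> x\<^sup>2"
  shows "x * ((c - x) * A1 c x) = (7 / (1 - t) - 7 / (2 * (1 + t)) + t / 2 + 1 / 2)
    - (7 / (1 - y) - 7 / (2 * (1 + y)) + y / 2 + 1 / 2)"
proof -
  have range: "0 < t" "t < 1" "0 < y" "y < 1"
    using assms mult_strict_mono[of c 1 x 1] by (auto simp: t_def y_def power_less_one_iff)
  define p q where "p = 1 / ((1 - y) * (1 - t))" and "q = 1 / ((1 + y) * (1 + t))"
  have p: "7 / (1 - t) - 7 / (1 - y) = 7 * ((t - y) * p)"
    and q: "7 / (2 * (1 + t)) - 7 / (2 * (1 + y)) = 7 / 2 * ((y - t) * q)"
    using range by (simp_all add: p_def q_def divide_simps) (simp_all add: algebra_simps)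
  have A1: "A1 c x = 7 * p + 7 / 2 * q + 1 / 2"
    by (simp add: A1_def t_def y_def p_def q_def mult.assoc)
  have "x * ((c - x) * A1 c x) = (t - y) * A1 c x"
    by (simp add: t_def y_def algebra_simps power2_eq_square)
  also have "\<dots> = 7 * ((t - y) * p) - 7 / 2 * ((y - t) * q) + (t - y) / 2"
    unfolding A1 by (simp add: field_simps)
  finally show ?thesis unfolding p[symmetric] q[symmetric] by (simp add: diff_divide_distrib)
qed

lemma A2_partial_fractions:
  assumes "0 < c" "c < 1" "0 < x" "x < 1"
  defines "t \<equiv> c * x" and "y \<equiv> x\<^sup>2"
  shows "x * ((c - x) * A2 c x) = (8 / (1 - t) - 2 / (1 + t) - 4 * t / (1 + t\<^sup>2) + 5 * t - 2)
    - (8 / (1 - y) - 2 / (1 + y) - 4 * y / (1 + y\<^sup>2) + 5 * y - 2)"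
proof -
  have range: "0 < t" "t < 1" "0 < y" "y < 1" "1 + t\<^sup>2 > 0" "1 + y\<^sup>2 > 0"
    using assms mult_strict_mono[of c 1 x 1]
    by (auto simp: t_def y_def power_less_one_iff add_pos_nonneg)
  define p q r where "p = 1 / ((1 - t) * (1 - y))" and "q = 1 / ((1 + t) * (1 + y))"
    and "r = 1 / ((1 + y\<^sup>2) * (1 + t\<^sup>2))"
  have p: "8 / (1 - t) - 8 / (1 - y) = 8 * ((t - y) * p)"
    and q: "2 / (1 + t) - 2 / (1 + y) = 2 * ((y - t) * q)"
    using range by (simp_all add: p_def q_def divide_simps)
  \<comment> \<open>The factor \<open>1 - t * y\<close> produced here explains the numerator
    \<open>c * x^3 - 1\<close> in \<open>A2\<close>, which is \<open>t * y - 1\<close>.\<close>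
  have r: "4 * t / (1 + t\<^sup>2) - 4 * y / (1 + y\<^sup>2) = 4 * ((t - y) * (1 - t * y) * r)"
    using range by (simp add: r_def divide_simps) (simp add: algebra_simps power2_eq_square)
  have "t * y = c * x ^ 3" "y\<^sup>2 = x ^ 4" "t\<^sup>2 = c\<^sup>2 * x\<^sup>2"
    by (simp_all add: t_def y_def power_mult_distrib power_numeral_reduce)
  then have A2: "A2 c x = 8 * p + 4 * (t * y - 1) * r + 5 + 2 * q"
    by (simp add: A2_def t_def[symmetric] y_def[symmetric] p_def q_def r_def)
  have "x * ((c - x) * A2 c x) = (t - y) * A2 c x"
    by (simp add: t_def y_def algebra_simps power2_eq_square)
  also have "\<dots> = 8 * ((t - y) * p) - 4 * ((t - y) * (1 - t * y) * r) + 5 * (t - y)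
      - 2 * ((y - t) * q)"
    unfolding A2 by (simp add: algebra_simps)
  finally show ?thesis unfolding p[symmetric] q[symmetric] r[symmetric] by simp
qed

lemma A1_pos:
  assumes "0 < c" "c < 1" "0 < x" "x < 1" shows "0 < A1 c x"
proof -
  have "c * x < 1" "x\<^sup>2 < 1"
    using assms mult_strict_mono[of c 1 x 1] by (auto simp: power_less_one_iff)
  then show ?thesis using assms unfolding A1_def
    by (intro add_pos_pos divide_pos_pos mult_pos_pos) (auto intro: add_pos_nonneg)
qed

text \<open>Only the second fraction can be negative; its numerator is at least -4 and its
  denominator at least 1, so the constant 5 outweighs it.\<close>

lemma A2_pos:
  assumes "0 < c" "c < 1" "0 < x" "x < 1" shows "0 < A2 c x"
proof -
  have "c * x < 1" "x\<^sup>2 < 1"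
    using assms mult_strict_mono[of c 1 x 1] by (auto simp: power_less_one_iff)
  then have "0 < 8 / ((1 - c * x) * (1 - x\<^sup>2))" "0 < 2 / ((1 + c * x) * (1 + x\<^sup>2))"
    using assms by (auto intro!: divide_pos_pos mult_pos_pos add_pos_nonneg)
  moreover have "-4 \<le> 4 * (c * x ^ 3 - 1) / ((1 + x ^ 4) * (1 + c\<^sup>2 * x\<^sup>2))"
  proof -
    have "1 * 1 \<le> (1 + x ^ 4) * (1 + c\<^sup>2 * x\<^sup>2)" by (intro mult_mono) auto
    moreover have "0 \<le> c * x ^ 3" using assms by simp
    ultimately show ?thesis by (simp add: le_divide_eq)
  qed
  ultimately show ?thesis unfolding A2_def by linarith
qed

section \<open>Combining the bounds; monotonicity of f\<close>

lemma ln_f_ratio_deriv_bounds: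
  assumes "0 < c" "c < 1" "c \<le> x" "x < 1"
  shows "c * x < 0.0729 \<Longrightarrow> deriv (\<lambda>t. ln (f_ratio c t)) x < (c - x) * A1 c x"
    and "deriv (\<lambda>t. ln (f_ratio c t)) x < (c - x) * A2 c x"
proof -
  have range: "0 < c * x" "c * x < 1" "0 < x\<^sup>2" "x\<^sup>2 < 1" "0 < x"
    using assms mult_strict_mono[of c 1 x 1] by (auto simp: power_less_one_iff)
  note deriv = DERIV_imp_deriv[OF ln_f_ratio_deriv(1)[OF assms(1,2) \<open>0 < x\<close> assms(4)]]
  have scale: "a / x < b" if "a < x * b" for a b :: real
    using that range by (simp add: divide_less_eq mult.commute)
  show "deriv (\<lambda>t. ln (f_ratio c t)) x < (c - x) * A2 c x"
    unfolding deriv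
    by (rule scale, subst A2_partial_fractions[OF assms(1,2) \<open>0 < x\<close> assms(4)])
      (use num_log_deriv_less[OF range(1,2)] den_log_deriv_greater[OF range(3,4)] in linarith)
  show "deriv (\<lambda>t. ln (f_ratio c t)) x < (c - x) * A1 c x" if "c * x < 0.0729"
    unfolding deriv
    by (rule scale, subst A1_partial_fractions[OF assms(1,2) \<open>0 < x\<close> assms(4)])
      (use num_log_deriv_less_small[OF range(1) that] den_log_deriv_greater'[OF range(3,4)] in linarith)
qed

theorem theorem1:
  fixes c :: real
  assumes "0.005 < c" and "c < 1"
  shows "(\<forall>x. c < x \<and> x < 1 \<longrightarrow>
            A1 c x > 0 \<and> A2 c x > 0
          \<and> (\<lambda>t. ln (f_ratio c t)) differentiable (at x)
          \<and> (if c < 0.27 \<and> x < 0.27\<^sup>2 / c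
             then deriv (\<lambda>t. ln (f_ratio c t)) x < (c - x) * A1 c x \<and> (c - x) * A1 c x < 0
             else deriv (\<lambda>t. ln (f_ratio c t)) x < (c - x) * A2 c x \<and> (c - x) * A2 c x < 0))
       \<and> strict_antimono_on {c..<1} (f_ratio c)"
proof (intro conjI allI impI)
  have "0 < c" using assms by simp
  fix x assume x: "c < x \<and> x < 1"
  then have "0 < x" using \<open>0 < c\<close> by simp
  show A: "A1 c x > 0" "A2 c x > 0"
    using A1_pos A2_pos \<open>0 < c\<close> \<open>0 < x\<close> assms x by auto
  show "(\<lambda>t. ln (f_ratio c t)) differentiable (at x)"
    by (rule real_differentiable_def[THEN iffD2, OF exI, OF ln_f_ratio_deriv(1)])
      (use \<open>0 < c\<close> \<open>0 < x\<close> assms x in auto)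
  have "c * x < 0.0729" if "x < 0.27\<^sup>2 / c"
    using that \<open>0 < c\<close> by (simp add: field_simps power2_eq_square)
  then show "if c < 0.27 \<and> x < 0.27\<^sup>2 / c
      then deriv (\<lambda>t. ln (f_ratio c t)) x < (c - x) * A1 c x \<and> (c - x) * A1 c x < 0
      else deriv (\<lambda>t. ln (f_ratio c t)) x < (c - x) * A2 c x \<and> (c - x) * A2 c x < 0"
    using ln_f_ratio_deriv_bounds[OF \<open>0 < c\<close> assms(2), of x] x A
    by (simp add: mult_less_0_iff)
next
  have "0 < c" using assms by simp
  show "strict_antimono_on {c..<1} (f_ratio c)"
  proof (rule monotone_onI)
    fix a b assume ab: "a \<in> {c..<1}" "b \<in> {c..<1}" "a < b"
    note deriv = ln_f_ratio_deriv(1)[OF \<open>0 < c\<close> assms(2)]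
    have "ln (f_ratio c b) < ln (f_ratio c a)"
    proof (rule DERIV_neg_imp_decreasing_open[OF \<open>a < b\<close>])
      show "continuous_on {a..b} (\<lambda>t. ln (f_ratio c t))"
        by (rule DERIV_continuous_on, rule has_field_derivative_at_within, rule deriv)
          (use ab \<open>0 < c\<close> in auto)
      fix x assume x: "a < x" "x < b"
      \<comment> \<open>The \<open>A2\<close> bound covers the whole range, so monotonicity needs no
        case distinction.\<close>
      have "deriv (\<lambda>t. ln (f_ratio c t)) x < (c - x) * A2 c x"
        using ab x by (intro ln_f_ratio_deriv_bounds(2) \<open>0 < c\<close> assms) auto
      also have "\<dots> \<le> 0"
        using ab x \<open>0 < c\<close> assms A2_pos[of c x] by (intro mult_nonpos_nonneg) auto
      finally have "deriv (\<lambda>t. ln (f_ratio c t)) x < 0" .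
      moreover have "((\<lambda>t. ln (f_ratio c t)) has_real_derivative deriv (\<lambda>t. ln (f_ratio c t)) x) (at x)"
        unfolding DERIV_deriv_iff_real_differentiable
        by (rule real_differentiable_def[THEN iffD2, OF exI, OF deriv]) (use ab x \<open>0 < c\<close> in auto)
      ultimately show "\<exists>y. ((\<lambda>t. ln (f_ratio c t)) has_real_derivative y) (at x) \<and> y < 0"
        by blast
    qed
    then show "f_ratio c b < f_ratio c a"
      using ab \<open>0 < c\<close> assms ln_f_ratio_deriv(2)[of c a] ln_f_ratio_deriv(2)[of c b] by simp
  qed
qed

end
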